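(* Let $r\ge 3$ be odd, let $q$ be a prime power, let $\mathcal L$ be an $m$-cover of $\mathcal W(r,q)$ and let $\bar{\mathcal L}$ be the set of points of $\mathcal W(r,q^2)$ lying on the extended lines of $\mathcal L$. Then $\bar{\mathcal L}$ is an $(m(q^2-q)+q+1)$-tight set of $\mathcal W(r,q^2)$ if and only if $\mathcal L$ is an $(r-2)$-dual cover of symplectic type.
   Context: $\theta_{n,q}=q^n+\dots+q+1$ for $n\ge0$, $\theta_{-1,q}=0$; $\theta_{n,q^2}$ is the same expression with $q^2$ in place of $q$. $\mathcal W(r,q)$ is the symplectic polar space of $\mathrm{PG}(r,q)$ given by a nondegenerate alternating form $b$ on $\mathbb F_q^{r+1}$, with polarity $\perp$. Its points are all points of $\mathrm{PG}(r,q)$ and its lines are the totally isotropic lines. An $m$-cover of $\mathcal W(r,q)$ ($m>0$) is a set $\mathcal L$ of lines of $\mathcal W(r,q)$ such that every point lies on exactly $m$ lines of $\mathcal L$. $\mathcal L$ is $(r-2)$-dual of symplectic type if for every line $\ell$ of $\mathrm{PG}(r,q)$ the number of lines of $\mathcal L$ contained in $\ell^\perp$ equals $\frac{m\theta_{r-4,q}}{q+1}+q^{r-3}$ if $\ell\in\mathcal L$, and $\frac{m\theta_{r-4,q}}{q+1}$ if $\ell\notin\mathcal L$. $\mathrm{PG}(r,q)$ is embedded in $\mathrm{PG}(r,q^2)$ by extension of scalars; the extended line of a line $\ell$ of $\mathrm{PG}(r,q)$ is the line of $\mathrm{PG}(r,q^2)$ containing the $q+1$ points of $\ell$. $\mathcal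 W(r,q^2)$ is the symplectic polar space of $\mathrm{PG}(r,q^2)$ given by the $\mathbb F_{q^2}$-bilinear extension of $b$; its polarity is also denoted $\perp$, and its points are all points of $\mathrm{PG}(r,q^2)$. A subset $\mathcal X$ of points of $\mathcal W(r,q^2)$ is $i$-tight if for every point $P$ of $\mathcal W(r,q^2)$, $|P^{\perp}\cap\mathcal X|$ equals $i\,\theta_{\frac{r-3}{2},q^2}+q^{r-1}$ if $P\in\mathcal X$ and $i\,\theta_{\frac{r-3}{2},q^2}$ if $P\notin\mathcal X$. *)

theory Defs
  imports "HOL-Analysis.Cartesian_Space"
begin

text \<open>
  The projective space PG(r,q) is the lattice of subspaces of \<open>'a ^ 'n\<close>, where
  \<open>'a\<close> is a finite field with q elements and \<open>CARD('n) = r + 1\<close>.  Points and lines are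
  the linear subspaces of dimension 1 and 2, and incidence is inclusion.
\<close>

text \<open>The index is an integer so that \<open>theta (-1) q = 0\<close> is covered.\<close>

definition theta :: "int \<Rightarrow> nat \<Rightarrow> nat" where
  "theta n q = (\<Sum>i<nat (n + 1). q ^ i)"

definition pg_points :: "('a::field ^ 'n) set set" where
  "pg_points = {P. vec.subspace P \<and> vec.dim P = 1}"

definition pg_lines :: "('a::field ^ 'n) set set" where
  "pg_lines = {l. vec.subspace l \<and> vec.dim l = 2}"

definition bilinear_form :: "('a::field ^ 'n \<Rightarrow> 'a ^ 'n \<Rightarrow> 'a) \<Rightarrow> bool" where
  "bilinear_form b \<longleftrightarrow>
     (\<forall>x. Vector_Spaces.linear (*s) (*) (\<lambda>y. b x y)) \<and>
     (\<forall>y. Vector_Spaces.linear (*s) (*) (\<lambda>x. b x y))"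

definition symplectic_form :: "('a::field ^ 'n \<Rightarrow> 'a ^ 'n \<Rightarrow> 'a) \<Rightarrow> bool" where
  "symplectic_form b \<longleftrightarrow>
     bilinear_form b \<and> (\<forall>x. b x x = 0) \<and> (\<forall>x. (\<forall>y. b x y = 0) \<longrightarrow> x = 0)"

definition perp :: "('a::field ^ 'n \<Rightarrow> 'a ^ 'n \<Rightarrow> 'a) \<Rightarrow> ('a ^ 'n) set \<Rightarrow> ('a ^ 'n) set" where
  "perp b S = {x. \<forall>y\<in>S. b x y = 0}"

definition symplectic_lines ::
    "('a::field ^ 'n \<Rightarrow> 'a ^ 'n \<Rightarrow> 'a) \<Rightarrow> ('a ^ 'n) set set" where
  "symplectic_lines b = {l \<in> pg_lines. l \<subseteq> perp b l}"

definition m_cover ::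
    "('a::field ^ 'n \<Rightarrow> 'a ^ 'n \<Rightarrow> 'a) \<Rightarrow> nat \<Rightarrow> ('a ^ 'n) set set \<Rightarrow> bool" where
  "m_cover b m L \<longleftrightarrow>
     0 < m \<and> L \<subseteq> symplectic_lines b \<and> (\<forall>P\<in>pg_points. card {l \<in> L. P \<subseteq> l} = m)"

definition dual_symplectic_type ::
    "nat \<Rightarrow> nat \<Rightarrow> ('a::field ^ 'n \<Rightarrow> 'a ^ 'n \<Rightarrow> 'a) \<Rightarrow> nat \<Rightarrow> ('a ^ 'n) set set \<Rightarrow> bool" where
  "dual_symplectic_type r q b m L \<longleftrightarrow>
     (\<forall>l\<in>pg_lines.
        real (card {k \<in> L. k \<subseteq> perp b l}) =
          (if l \<in> L
           then real m * real (theta (int r - 4) q) / (real q + 1) + real q ^ (r - 3)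
           else real m * real (theta (int r - 4) q) / (real q + 1)))"

text \<open>
  The field extension is given by a ring homomorphism
  (automatically injective, both rings being fields).
\<close>

definition field_embedding :: "('a::field \<Rightarrow> 'b::field) \<Rightarrow> bool" where
  "field_embedding \<phi> \<longleftrightarrow>
     \<phi> 1 = 1 \<and> (\<forall>x y. \<phi> (x + y) = \<phi> x + \<phi> y) \<and> (\<forall>x y. \<phi> (x * y) = \<phi> x * \<phi> y)"

definition ext_vec :: "('a \<Rightarrow> 'b) \<Rightarrow> 'a ^ 'n \<Rightarrow> 'b ^ 'n" where
  "ext_vec \<phi> x = (\<chi> i. \<phi> (x $ i))"

definition ext_line :: "('a::field \<Rightarrow> 'b::field) \<Rightarrow> ('a ^ 'n) set \<Rightarrow> ('b ^ 'n) set" where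
  "ext_line \<phi> l = vec.span (ext_vec \<phi> ` l)"

definition ext_points :: "('a::field \<Rightarrow> 'b::field) \<Rightarrow> ('a ^ 'n) set set \<Rightarrow> ('b ^ 'n) set set" where
  "ext_points \<phi> L = {P \<in> pg_points. \<exists>l\<in>L. P \<subseteq> ext_line \<phi> l}"

text \<open>
  The bilinear extension of \<open>b\<close> is the form with the same Gram matrix in the standard basis;
  \<open>bilinear_form_ext_form\<close>, \<open>ext_form_ext_vec\<close> and \<open>ext_form_unique\<close> below
  show that it is the only bilinear form extending \<open>b\<close>.
\<close>

definition ext_form ::
    "('a::field \<Rightarrow> 'b::field) \<Rightarrow> ('a ^ 'n \<Rightarrow> 'a ^ 'n \<Rightarrow> 'a) \<Rightarrow> 'b ^ 'n \<Rightarrow> 'b ^ 'n \<Rightarrow> 'b" where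
  "ext_form \<phi> b x y = (\<Sum>i\<in>UNIV. \<Sum>j\<in>UNIV. x $ i * y $ j * \<phi> (b (axis i 1) (axis j 1)))"

lemma bilinear_form_ext_form: "bilinear_form (ext_form \<phi> b)"
  unfolding bilinear_form_def ext_form_def
  by (auto intro!: Vector_Spaces.linear.intro module_hom.intro module_hom_axioms.intro
        vec.vector_space_axioms vector_space_over_itself.vector_space_axioms
        vec.module_axioms vector_space_over_itself.module_axioms
        simp: sum_distrib_left sum.distrib algebra_simps)

lemma bilinear_form_expand:
  assumes "bilinear_form B"
  shows "B x y = (\<Sum>i\<in>UNIV. \<Sum>j\<in>UNIV. x $ i * y $ j * B (axis i 1) (axis j 1))"
proof -
  have l: "B (\<Sum>i\<in>UNIV. x $ i *s axis i 1) z = (\<Sum>i\<in>UNIV. x $ i * B (axis i 1) z)" for z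
  proof -
    interpret l: Vector_Spaces.linear "(*s)" "(*)" "\<lambda>x. B x z"
      using assms by (simp add: bilinear_form_def)
    show ?thesis by (simp only: l.sum l.scale)
  qed
  have r: "B z (\<Sum>j\<in>UNIV. y $ j *s axis j 1) = (\<Sum>j\<in>UNIV. y $ j * B z (axis j 1))" for z
  proof -
    interpret r: Vector_Spaces.linear "(*s)" "(*)" "\<lambda>y. B z y"
      using assms by (simp add: bilinear_form_def)
    show ?thesis by (simp only: r.sum r.scale)
  qed
  show ?thesis
    using l[of y] r by (simp add: basis_expansion sum_distrib_left mult.assoc)
qed

lemma ext_form_ext_vec:
  fixes b :: "'a::field ^ 'n \<Rightarrow> 'a ^ 'n \<Rightarrow> 'a"
  assumes "field_embedding \<phi>" "bilinear_form b"
  shows "ext_form \<phi> b (ext_vec \<phi> x) (ext_vec \<phi> y) = \<phi> (b x y)"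
proof -
  have 0: "\<phi> 0 = 0"
    using assms(1) unfolding field_embedding_def by (metis add_cancel_right_right add_0)
  have sum: "\<phi> (sum f UNIV) = (\<Sum>i\<in>UNIV. \<phi> (f i))" for f :: "'n \<Rightarrow> 'a"
    using assms(1) 0 sum_comp_morphism[of \<phi> f UNIV]
    by (simp add: field_embedding_def o_def)
  show ?thesis
    using assms(1) bilinear_form_expand[OF assms(2), of x y]
    by (simp add: ext_form_def ext_vec_def sum field_embedding_def)
qed

lemma ext_form_unique:
  assumes "field_embedding \<phi>" "bilinear_form b" "bilinear_form B"
    and "\<And>x y. B (ext_vec \<phi> x) (ext_vec \<phi> y) = \<phi> (b x y)"
  shows "B = ext_form \<phi> b"
proof (intro ext)
  fix x y
  have 0: "\<phi> 0 = 0"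
    using assms(1) unfolding field_embedding_def by (metis add_cancel_right_right add_0)
  have "ext_vec \<phi> (axis i 1) = axis i 1" for i
    using assms(1) 0 by (auto simp: ext_vec_def axis_def vec_eq_iff field_embedding_def)
  then have "B (axis i 1) (axis j 1) = \<phi> (b (axis i 1) (axis j 1))" for i j
    by (metis assms(4))
  then show "B x y = ext_form \<phi> b x y"
    using bilinear_form_expand[OF assms(3), of x y] by (simp add: ext_form_def)
qed

text \<open>
  Here \<open>q\<close> is the order of the subfield; the form \<open>B\<close> lives over the field with
  \<open>q\<^sup>2\<close> elements, which is why \<open>q ^ (r - 1)\<close> and \<open>theta _ (q\<^sup>2)\<close> both occur.
\<close>

definition tight_set ::
    "nat \<Rightarrow> nat \<Rightarrow> ('b::field ^ 'n \<Rightarrow> 'b ^ 'n \<Rightarrow> 'b) \<Rightarrow> nat \<Rightarrow> ('b ^ 'n) set set \<Rightarrow> bool" where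
  "tight_set r q B i X \<longleftrightarrow>
     X \<subseteq> pg_points \<and>
     (\<forall>P\<in>pg_points.
        card {Q \<in> X. Q \<subseteq> perp B P} =
          (if P \<in> X then i * theta ((int r - 3) div 2) (q\<^sup>2) + q ^ (r - 1)
           else i * theta ((int r - 3) div 2) (q\<^sup>2)))"

end

theory Submission
  imports Defs
begin

text \<open>
  Every vector over the extension field is uniquely \<open>x + \<omega> y\<close> with \<open>x\<close>, \<open>y\<close> over the
  subfield, so a point \<open>P\<close> either comes from a point of PG(r,q), or lies on the extension of
  exactly one line \<open>l = \<langle>x, y\<rangle>\<close>; let \<open>W\<close> be the trace of \<open>P\<^sup>\<bottom>\<close> on PG(r,q), which
  is a hyperplane in the first case and \<open>l\<^sup>\<bottom>\<close> in the second.  Count incident pairs of an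
  extended line of \<open>L\<close> and a point in \<open>P\<^sup>\<bottom>\<close>:  an extended line has \<open>q\<^sup>2 + 1\<close> points
  in \<open>P\<^sup>\<bottom>\<close> if the line is in \<open>W\<close> and one point otherwise, whereas a point of the cover is
  on \<open>m\<close> extended lines or on one, according to whether it comes from PG(r,q).  Hence, with
  \<open>a\<close> lines of \<open>L\<close> in \<open>W\<close> and \<open>w\<close> points in \<open>W\<close>, the number \<open>N\<close> of points of the
  cover in \<open>P\<^sup>\<bottom>\<close> satisfies \<open>N + m w = |L| + q\<^sup>2 a + w\<close>.  If \<open>W\<close> is a hyperplane, the
  same count over the subfield gives \<open>|L| + q a = m w\<close> and tightness at \<open>P\<close> is automatic;
  otherwise \<open>N\<close> is an affine function of \<open>a\<close> and the two conditions match line by line.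
\<close>

section \<open>Points and lines as spans of one or two vectors\<close>

lemma pg_points_iff: "P \<in> pg_points \<longleftrightarrow> (\<exists>x. x \<noteq> 0 \<and> P = vec.span {x})"
proof
  assume P: "P \<in> pg_points"
  obtain B where B: "B \<subseteq> P" "vec.independent B" "P \<subseteq> vec.span B" "card B = vec.dim P"
    using vec.basis_exists by blast
  then obtain x where x: "B = {x}"
    using P by (auto simp: pg_points_def card_1_singleton_iff)
  have "P = vec.span {x}"
    using B P x vec.span_minimal[of B P] by (auto simp: pg_points_def)
  moreover have "x \<noteq> 0"
    using B(2) x vec.dependent_zero by blast
  ultimately show "\<exists>x. x \<noteq> 0 \<and> P = vec.span {x}" by blast
next
  assume "\<exists>x. x \<noteq> 0 \<and> P = vec.span {x}"
  then obtain x where "x \<noteq> 0" "P = vec.span {x}" by blast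
  then show "P \<in> pg_points"
    using vec.dim_span_eq_card_independent[of "{x}"]
    by (simp add: pg_points_def)
qed

text \<open>The conjunct \<open>x \<noteq> y\<close> excludes the collapsed set
  \<open>{x, x}\<close>, which is independent for nonzero \<open>x\<close> although it spans only a
  point.\<close>

lemma independent_pair_iff:
  "x \<noteq> y \<and> vec.independent {x, y} \<longleftrightarrow> x \<noteq> 0 \<and> y \<notin> vec.span {x}"
proof (cases "x = y")
  case False
  then show ?thesis
    using vec.independent_insert[of y "{x}"] by (auto simp: insert_commute)
qed (auto intro: vec.span_base)

lemma pg_lines_iff:
  "l \<in> pg_lines \<longleftrightarrow> (\<exists>x y. x \<noteq> 0 \<and> y \<notin> vec.span {x} \<and> l = vec.span {x, y})"
proof
  assume l: "l \<in> pg_lines"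
  obtain B where B: "B \<subseteq> l" "vec.independent B" "l \<subseteq> vec.span B" "card B = vec.dim l"
    using vec.basis_exists by blast
  then obtain x y where xy: "B = {x, y}" "x \<noteq> y"
    using l by (auto simp: pg_lines_def card_2_iff)
  have "l = vec.span {x, y}"
    using B l xy vec.span_minimal[of B l] by (auto simp: pg_lines_def)
  then show "\<exists>x y. x \<noteq> 0 \<and> y \<notin> vec.span {x} \<and> l = vec.span {x, y}"
    using B(2) xy independent_pair_iff by blast
next
  assume "\<exists>x y. x \<noteq> 0 \<and> y \<notin> vec.span {x} \<and> l = vec.span {x, y}"
  then obtain x y where "x \<noteq> y" "vec.independent {x, y}" "l = vec.span {x, y}"
    using independent_pair_iff by blast
  then show "l \<in> pg_lines"
    using vec.dim_span_eq_card_independent[of "{x, y}"]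
    by (simp add: pg_lines_def)
qed

lemma pg_points_subspace: "P \<in> pg_points \<Longrightarrow> vec.subspace P"
  and pg_lines_subspace: "l \<in> pg_lines \<Longrightarrow> vec.subspace l"
  by (simp_all add: pg_points_def pg_lines_def)

lemma span_singleton_subset_iff: "vec.subspace W \<Longrightarrow> vec.span {x} \<subseteq> W \<longleftrightarrow> x \<in> W"
  using vec.span_base[of x "{x}"] vec.span_minimal[of "{x}" W] by auto

lemma span_pair_subset_iff: "vec.subspace W \<Longrightarrow> vec.span {x, y} \<subseteq> W \<longleftrightarrow> x \<in> W \<and> y \<in> W"
  using vec.span_superset[of "{x, y}"] vec.span_minimal[of "{x, y}" W] by auto

text \<open>Every nonzero vector of a point is an invertible multiple of its generator. Hence
  distinct points share only the zero vector.\<close>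

lemma pg_point_eq_span:
  assumes "P \<in> pg_points" "v \<in> P" "v \<noteq> 0"
  shows "P = vec.span {v}"
proof -
  obtain x where x: "P = vec.span {x}"
    using assms(1) pg_points_iff by blast
  then obtain k where k: "v = k *s x"
    using assms(2) by (auto simp: vec.span_singleton)
  then have "k \<noteq> 0" using assms(3) by auto
  then have "x = inverse k *s v" using k by (simp add: vec.scale_scale)
  then have "x \<in> vec.span {v}" by (metis vec.span_base vec.span_scale singletonI)
  then show ?thesis
    using x assms(2) by (intro subset_antisym) (simp_all add: span_singleton_subset_iff)
qed

text \<open>The span of the two vectors lies in \<open>l\<close> and already has dimension 2. This
  gives the uniqueness of the line through two points.\<close>

lemma pg_line_eq_span:
  assumes l: "l \<in> pg_lines" "x \<in> l" "y \<in> l" and xy: "x \<noteq> 0" "y \<notin> vec.span {x}"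
  shows "l = vec.span {x, y}"
proof -
  have "vec.span {x, y} \<subseteq> l"
    using l by (simp add: span_pair_subset_iff pg_lines_subspace)
  moreover have "vec.dim (vec.span {x, y}) = 2"
    using xy pg_lines_iff[of "vec.span {x, y}"] by (auto simp: pg_lines_def)
  ultimately show ?thesis
    using l vec.subspace_dim_equal[of "vec.span {x, y}" l]
    by (auto simp: pg_lines_def)
qed

section \<open>Counting vectors and points in subspaces\<close>

lemma card_pg_point:
  fixes P :: "('a::{field,finite} ^ 'n) set"
  assumes "P \<in> pg_points"
  shows "card P = CARD('a)"
proof -
  obtain x where "x \<noteq> 0" "P = vec.span {x}"
    using assms pg_points_iff by blast
  then show ?thesis
    by (simp add: vec.span_singleton card_image inj_on_def)
qed

lemma card_pg_line:
  fixes l :: "('a::{field,finite} ^ 'n) set"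
  assumes "l \<in> pg_lines"
  shows "card l = CARD('a) ^ 2"
proof -
  obtain x y where xy: "x \<noteq> 0" "y \<notin> vec.span {x}" and l: "l = vec.span {x, y}"
    using assms pg_lines_iff by blast
  let ?f = "\<lambda>(a, c). a *s x + c *s y"
  have "inj ?f"
  proof (rule injI, clarsimp)
    fix a c a' c' assume e: "a *s x + c *s y = a' *s x + c' *s y"
    then have e': "(c - c') *s y = (a' - a) *s x"
      by (simp add: vec.scale_left_diff_distrib algebra_simps)
    have "c = c'"
    proof (rule ccontr)
      assume "c \<noteq> c'"
      then have "y = inverse (c - c') *s ((c - c') *s y)"
        by (simp only: vec.scale_scale) simp
      then have "y = (inverse (c - c') * (a' - a)) *s x"
        by (simp only: e' vec.scale_scale)
      then show False using xy by (auto simp: vec.span_singleton)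
    qed
    then show "a = a' \<and> c = c'" using e xy by simp
  qed
  moreover have "l = range ?f"
  proof -
    have "v \<in> l \<longleftrightarrow> (\<exists>a c. v = a *s x + c *s y)" for v
      unfolding l by (auto simp: vec.span_breakdown_eq vec.span_singleton image_iff algebra_simps)
    then show ?thesis by (auto simp: image_iff)
  qed
  ultimately show ?thesis
    by (simp add: card_image power2_eq_square)
qed

definition points_in :: "('a::field ^ 'n) set \<Rightarrow> ('a ^ 'n) set set" where
  "points_in W = {Q \<in> pg_points. Q \<subseteq> W}"

text \<open>The points in \<open>W\<close> cut its nonzero vectors into disjoint blocks of size
  \<open>CARD('a) - 1\<close>.\<close>

lemma card_points_in:
  fixes W :: "('a::{field,finite} ^ 'n) set"
  assumes W: "vec.subspace W"
  shows "card W = (CARD('a) - 1) * card (points_in W) + 1"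
proof -
  have "W - {0} = (\<Union>Q\<in>points_in W. Q - {0})"
  proof (intro equalityI subsetI)
    fix v assume v: "v \<in> W - {0}"
    then have "vec.span {v} \<in> points_in W"
      using W by (auto simp: points_in_def pg_points_iff span_singleton_subset_iff)
    then show "v \<in> (\<Union>Q\<in>points_in W. Q - {0})"
      using v vec.span_base[of v "{v}"] by blast
  qed (auto simp: points_in_def)
  also have "card \<dots> = (\<Sum>Q\<in>points_in W. card (Q - {0}))"
  proof (rule card_UN_disjoint)
    show "\<forall>i\<in>points_in W. \<forall>j\<in>points_in W. i \<noteq> j \<longrightarrow> (i - {0}) \<inter> (j - {0}) = {}"
      using pg_point_eq_span unfolding points_in_def by blast
  qed auto
  also have "\<dots> = (\<Sum>Q\<in>points_in W. CARD('a) - 1)"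
    by (rule sum.cong)
      (auto simp: points_in_def card_pg_point vec.subspace_0 pg_points_subspace)
  finally have "card (W - {0}) = (CARD('a) - 1) * card (points_in W)" by simp
  moreover have "card W = card (W - {0}) + 1"
    using card.remove[of W 0] vec.subspace_0[OF W] by (simp del: card_Diff_insert)
  ultimately show ?thesis by simp
qed

text \<open>A vector of \<open>W\<close> on which \<open>f\<close> takes the value 1 splits
  \<open>W\<close> into a copy of the field and the kernel. The product form avoids division of
  natural numbers.\<close>

lemma card_kernel:
  fixes W :: "('a::{field,finite} ^ 'n) set" and f :: "'a ^ 'n \<Rightarrow> 'a"
  assumes W: "vec.subspace W"
    and add: "\<And>x y. f (x + y) = f x + f y" and scale: "\<And>c x. f (c *s x) = c * f x"
    and u: "u \<in> W" "f u \<noteq> 0"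
  shows "card W = CARD('a) * card {w \<in> W. f w = 0}"
proof -
  define e where "e = inverse (f u) *s u"
  have e: "e \<in> W" "f e = 1"
    using u W by (auto simp: e_def scale vec.subspace_scale)
  let ?g = "\<lambda>(c, w). c *s e + w"
  have "bij_betw ?g (UNIV \<times> {w \<in> W. f w = 0}) W"
  proof (rule bij_betwI[where g = "\<lambda>w. (f w, w - f w *s e)"])
    have minus: "f (x - c *s e) = f x - c" for x c
      using add[of x "(- c) *s e"] scale[of "- c" e] e by simp
    show "?g \<in> UNIV \<times> {w \<in> W. f w = 0} \<rightarrow> W"
      using e W by (auto intro!: vec.subspace_add vec.subspace_scale)
    show "(\<lambda>w. (f w, w - f w *s e)) \<in> W \<rightarrow> UNIV \<times> {w \<in> W. f w = 0}"
      using e W by (auto simp: minus intro!: vec.subspace_diff vec.subspace_scale)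
  qed (auto simp: add scale e)
  then have "card ((UNIV :: 'a set) \<times> {w \<in> W. f w = 0}) = card W"
    by (rule bij_betw_same_card)
  then show ?thesis by (simp add: card_cartesian_product)
qed

section \<open>Bilinear forms, hyperplane sections of lines, and incidence sums over a cover\<close>

lemma bilinear_formD:
  assumes "bilinear_form B"
  shows "B (x + y) z = B x z + B y z" "B (c *s x) z = c * B x z"
    "B z (x + y) = B z x + B z y" "B z (c *s x) = c * B z x"
    "B 0 z = 0" "B z 0 = 0"
proof -
  interpret l: Vector_Spaces.linear "(*s)" "(*)" "\<lambda>x. B x z"
    using assms by (simp add: bilinear_form_def)
  interpret r: Vector_Spaces.linear "(*s)" "(*)" "\<lambda>y. B z y"
    using assms by (simp add: bilinear_form_def)
  show "B (x + y) z = B x z + B y z" "B (c *s x) z = c * B x z"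
    "B z (x + y) = B z x + B z y" "B z (c *s x) = c * B z x"
    "B 0 z = 0" "B z 0 = 0"
    by (simp_all only: l.add l.scale r.add r.scale l.zero r.zero)
qed

lemma subspace_perp:
  assumes "bilinear_form B"
  shows "vec.subspace (perp B S)"
  by (auto simp: vec.subspace_def perp_def bilinear_formD[OF assms])

lemma perp_span:
  assumes "bilinear_form B"
  shows "perp B (vec.span S) = perp B S"
proof -
  have "B x y = 0" if "\<forall>y\<in>S. B x y = 0" "y \<in> vec.span S" for x y
    using that(2) vec.subspace_def[of "{y. B x y = 0}"] vec.span_minimal[of S "{y. B x y = 0}"] that(1)
    by (auto simp: bilinear_formD[OF assms])
  then show ?thesis
    using vec.span_superset[of S] by (auto simp: perp_def)
qed

lemma subspace_kernel:
  fixes f :: "'a::field ^ 'n \<Rightarrow> 'a"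
  assumes "\<And>x y. f (x + y) = f x + f y" "\<And>c x. f (c *s x) = c * f x"
  shows "vec.subspace {v. f v = 0}"
  using assms(2)[of 0 0] by (auto simp: vec.subspace_def assms)

text \<open>A line not inside the kernel meets it in \<open>CARD('a)\<close> vectors, hence in one
  point. The zero functional is allowed and then counts all points of the line. The lemma serves
  over both fields.\<close>

lemma card_points_in_line_kernel:
  fixes l :: "('a::{field,finite} ^ 'n) set" and f :: "'a ^ 'n \<Rightarrow> 'a"
  assumes l: "l \<in> pg_lines"
    and add: "\<And>x y. f (x + y) = f x + f y" and scale: "\<And>c x. f (c *s x) = c * f x"
  shows "card (points_in (l \<inter> {v. f v = 0})) = (if l \<subseteq> {v. f v = 0} then CARD('a) + 1 else 1)"
proof -
  let ?K = "l \<inter> {v. f v = 0}"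
  have "card {0, 1 :: 'a} \<le> CARD('a)"
    by (rule card_mono) auto
  \<comment> \<open>Writing the order as \<open>Suc k\<close> removes the truncated subtraction of
    \<open>card_points_in\<close>, and \<open>k > 0\<close> permits cancellation.\<close>
  then obtain k where k: "CARD('a) = Suc k" "k > 0"
    by (cases "CARD('a)") auto
  have l': "vec.subspace l"
    using l by (rule pg_lines_subspace)
  have K: "vec.subspace ?K"
    using l' subspace_kernel[of f] add scale by (intro vec.subspace_inter) auto
  note eq = card_points_in[OF K]
  show ?thesis
  proof (cases "l \<subseteq> {v. f v = 0}")
    case True
    then have "?K = l" by blast
    then have "(k + 1)\<^sup>2 = k * card (points_in l) + 1"
      using eq card_pg_line[OF l] k by simp
    then have "k * card (points_in l) = k * (k + 2)"
      by (simp add: power2_eq_square)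
    then have "card (points_in l) = k + 2"
      by (rule nat_mult_eq_cancel1[OF k(2), THEN iffD1])
    then show ?thesis
      using True by (simp only: \<open>?K = l\<close> k(1)) simp
  next
    case False
    then obtain u where u: "u \<in> l" "f u \<noteq> 0" by blast
    have "CARD('a) * CARD('a) = CARD('a) * card {w \<in> l. f w = 0}"
      using card_kernel[OF l' add scale u] card_pg_line[OF l] by (simp add: power2_eq_square)
    moreover have "{w \<in> l. f w = 0} = ?K" by blast
    ultimately have "card ?K = CARD('a)" by simp
    then show ?thesis
      using eq False k by simp
  qed
qed

text \<open>Double counting of the pairs of a line of \<open>L\<close> and a point of
  \<open>W\<close> on it.\<close>

lemma sum_points_in_cover:
  fixes L :: "('a::{field,finite} ^ 'n) set set"
  assumes cover: "\<And>P. P \<in> pg_points \<Longrightarrow> card {l \<in> L. P \<subseteq> l} = m"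
  shows "(\<Sum>l\<in>L. card (points_in (l \<inter> W))) = m * card (points_in W)"
proof -
  have "(\<Sum>l\<in>L. card (points_in (l \<inter> W))) = (\<Sum>l\<in>L. card {P \<in> points_in W. P \<subseteq> l})"
    by (intro sum.cong arg_cong[where f = card]) (auto simp: points_in_def)
  also have "\<dots> = (\<Sum>P\<in>points_in W. m)"
    by (rule sum_multicount_gen) (auto simp: points_in_def cover)
  finally show ?thesis by simp
qed

text \<open>Every line gives one point of a hyperplane, and a line inside it gives \<open>c\<close>
  more, where \<open>c\<close> will be the order of the field in question.\<close>

lemma sum_two_valued:
  fixes c :: nat
  assumes "finite A"
  shows "(\<Sum>x\<in>A. if Q x then c + 1 else 1) = card A + c * card {x \<in> A. Q x}"
proof -
  have "(\<Sum>x\<in>A. if Q x then c + 1 else 1) = (\<Sum>x\<in>A. 1 + (if Q x then c else 0))"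
    by (rule sum.cong) auto
  also have "\<dots> = card A + c * card {x \<in> A. Q x}"
    using assms by (simp only: sum.distrib) (simp add: sum.If_cases Int_def)
  finally show ?thesis .
qed

section \<open>Coordinates over the quadratic extension with respect to 1 and \<omega>\<close>

locale quadratic_extension =
  fixes \<phi> :: "'a::{field,finite} \<Rightarrow> 'b::{field,finite}" and \<omega> :: 'b
  assumes embedding: "field_embedding \<phi>"
    and card_ext: "CARD('b) = CARD('a)\<^sup>2"
    and omega: "\<omega> \<notin> range \<phi>"
begin

lemma hom: "\<phi> 1 = 1" "\<phi> (x + y) = \<phi> x + \<phi> y" "\<phi> (x * y) = \<phi> x * \<phi> y"
  using embedding by (auto simp: field_embedding_def)

lemma hom_0: "\<phi> 0 = 0"
  using hom(2)[of 0 0] by (metis add_0 add_right_cancel)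

lemma hom_eq_0_iff: "\<phi> x = 0 \<longleftrightarrow> x = 0"
proof
  assume "\<phi> x = 0"
  then have "\<phi> (x * inverse x) = 0" by (simp add: hom)
  then show "x = 0" using hom(1) by (metis right_inverse zero_neq_one)
qed (simp add: hom_0)

lemma hom_diff: "\<phi> (x - y) = \<phi> x - \<phi> y"
  using hom(2)[of "x - y" y] by simp

lemma hom_divide: "y \<noteq> 0 \<Longrightarrow> \<phi> (x / y) = \<phi> x / \<phi> y"
  using hom(3)[of "x / y" y] hom_eq_0_iff by (simp add: field_simps)

text \<open>A nonzero \<open>c\<close> would put \<omega> into the image of \<open>\<phi>\<close>,
  so 1 and \<omega> are independent over the subfield.\<close>

lemma coords_eq_0: "\<phi> a + \<omega> * \<phi> c = 0 \<longleftrightarrow> a = 0 \<and> c = 0"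
proof
  assume e: "\<phi> a + \<omega> * \<phi> c = 0"
  have "c = 0"
  proof (rule ccontr)
    assume c: "c \<noteq> 0"
    have "\<omega> * \<phi> c = \<phi> 0 - \<phi> a"
      using e by (simp add: hom_0 eq_neg_iff_add_eq_0 add.commute)
    then have "\<omega> * \<phi> c = \<phi> (0 - a)"
      by (simp only: hom_diff)
    then have "\<omega> = \<phi> (0 - a) / \<phi> c"
      using c by (simp add: nonzero_eq_divide_eq hom_eq_0_iff)
    then have "\<omega> = \<phi> ((0 - a) / c)"
      by (simp only: hom_divide[OF c])
    then show False using omega by blast
  qed
  then show "a = 0 \<and> c = 0" using e by (simp add: hom_0 hom_eq_0_iff)
qed (simp add: hom_0)

lemma coords_inject: "\<phi> a + \<omega> * \<phi> c = \<phi> a' + \<omega> * \<phi> c' \<longleftrightarrow> a = a' \<and> c = c'"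
  using coords_eq_0[of "a - a'" "c - c'"] by (auto simp: hom_diff algebra_simps)

text \<open>The coordinate map is injective between sets of equal finite size, hence onto.\<close>

lemma coords_exist: "\<exists>a c. z = \<phi> a + \<omega> * \<phi> c"
proof -
  let ?f = "\<lambda>(a, c). \<phi> a + \<omega> * \<phi> c"
  have "inj ?f" by (auto simp: inj_def coords_inject)
  then have "card (range ?f) = CARD('b)"
    by (simp add: card_image card_ext power2_eq_square)
  then have "range ?f = UNIV"
    by (intro card_subset_eq) auto
  then have "z \<in> range ?f" by simp
  then show ?thesis by auto
qed

definition combine :: "'a ^ 'n \<Rightarrow> 'a ^ 'n \<Rightarrow> 'b ^ 'n" where
  "combine x y = ext_vec \<phi> x + \<omega> *s ext_vec \<phi> y"

lemma combine_inject: "combine x y = combine x' y' \<longleftrightarrow> x = x' \<and> y = y'"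
  by (auto simp: combine_def ext_vec_def vec_eq_iff coords_inject)

lemma combine_exist: "\<exists>x y. v = combine x y"
proof -
  have "\<forall>i. \<exists>a c. v $ i = \<phi> a + \<omega> * \<phi> c"
    using coords_exist by blast
  then obtain f g where "\<forall>i. v $ i = \<phi> (f i) + \<omega> * \<phi> (g i)" by metis
  then have "v = combine (\<chi> i. f i) (\<chi> i. g i)"
    by (simp add: combine_def ext_vec_def vec_eq_iff)
  then show ?thesis by blast
qed

lemma ext_vec_add: "ext_vec \<phi> (x + y) = ext_vec \<phi> x + ext_vec \<phi> y"
  and ext_vec_scale: "ext_vec \<phi> (a *s x) = \<phi> a *s ext_vec \<phi> x"
  and ext_vec_0: "ext_vec \<phi> 0 = 0"
  by (simp_all add: ext_vec_def vec_eq_iff hom hom_0)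

lemma combine_0_right: "combine x 0 = ext_vec \<phi> x"
  by (simp add: combine_def ext_vec_0)

lemma combine_add: "combine x y + combine x' y' = combine (x + x') (y + y')"
  by (simp add: combine_def ext_vec_add vec.scale_right_distrib algebra_simps)

lemma combine_eq_0_iff: "combine x y = 0 \<longleftrightarrow> x = 0 \<and> y = 0"
  using combine_inject[of x y 0 0] by (simp add: combine_def ext_vec_0)

text \<open>Multiplication by \<open>c\<close> is linear over the subfield, with coefficients read
  off from the quadratic equation of \<omega>. They are fixed before \<open>x\<close> and
  \<open>y\<close>, and the new components stay in every subspace that contains \<open>x\<close> and
  \<open>y\<close>.\<close>

lemma scale_combine:
  "\<exists>a d e f. \<forall>x y. c *s combine x y = combine (a *s x + d *s y) (e *s x + f *s y)"
proof -
  obtain s t where st: "\<omega> * \<omega> = \<phi> s + \<omega> * \<phi> t" using coords_exist by blast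
  obtain a d where c: "c = \<phi> a + \<omega> * \<phi> d" using coords_exist by blast
  have "c *s combine x y = combine (a *s x + (s * d) *s y) (d *s x + (a + t * d) *s y)"
    for x y :: "'a ^ 'n"
  proof (subst vec_eq_iff, rule allI)
    fix i
    let ?x = "\<phi> (x $ i)" and ?y = "\<phi> (y $ i)"
    have "c * (?x + \<omega> * ?y) = \<phi> a * ?x + \<omega> * (\<phi> a * ?y + \<phi> d * ?x) + (\<omega> * \<omega>) * (\<phi> d * ?y)"
      by (simp add: c algebra_simps)
    then show "(c *s combine x y) $ i =
        combine (a *s x + (s * d) *s y) (d *s x + (a + t * d) *s y) $ i"
      unfolding st by (simp add: combine_def ext_vec_def hom algebra_simps)
  qed
  then show ?thesis by blast
qed

text \<open>By \<open>scale_combine\<close>, the combinations with both components in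
  \<open>l\<close> are already closed under the large field, so the span defining
  \<open>ext_line\<close> contains nothing else.\<close>

lemma combine_mem_ext_line_iff:
  assumes l: "vec.subspace l"
  shows "combine x y \<in> ext_line \<phi> l \<longleftrightarrow> x \<in> l \<and> y \<in> l"
proof
  assume "x \<in> l \<and> y \<in> l"
  then show "combine x y \<in> ext_line \<phi> l"
    unfolding combine_def ext_line_def
    by (intro vec.span_add vec.span_scale vec.span_base) auto
next
  let ?S = "(\<lambda>(x, y). combine x y) ` (l \<times> l)"
  have "vec.subspace ?S"
    unfolding vec.subspace_def
  proof (intro conjI ballI allI)
    show "0 \<in> ?S"
      using combine_eq_0_iff[of 0 0] vec.subspace_0[OF l] by (force simp: image_iff)
    show "u + v \<in> ?S" if "u \<in> ?S" "v \<in> ?S" for u v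
      using that vec.subspace_add[OF l] by (fastforce simp: combine_add)
    show "c *s v \<in> ?S" if v: "v \<in> ?S" for c v
    proof -
      obtain x y where "v = combine x y" "x \<in> l" "y \<in> l" using v by auto
      moreover obtain a d e f
        where "c *s combine x y = combine (a *s x + d *s y) (e *s x + f *s y)"
        using scale_combine by blast
      ultimately show ?thesis
        using vec.subspace_add[OF l] vec.subspace_scale[OF l] by auto
    qed
  qed
  moreover have "ext_vec \<phi> ` l \<subseteq> ?S"
    using vec.subspace_0[OF l] by (force simp flip: combine_0_right)
  ultimately have "ext_line \<phi> l \<subseteq> ?S"
    unfolding ext_line_def by (intro vec.span_minimal)
  moreover assume "combine x y \<in> ext_line \<phi> l"
  ultimately show "x \<in> l \<and> y \<in> l" by (auto simp: combine_inject)
qed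

lemma ext_vec_mem_ext_line_iff:
  "vec.subspace l \<Longrightarrow> ext_vec \<phi> x \<in> ext_line \<phi> l \<longleftrightarrow> x \<in> l"
  using combine_mem_ext_line_iff[of l x 0] vec.subspace_0 by (auto simp: combine_0_right)

lemma ext_line_subset_iff:
  "vec.subspace W \<Longrightarrow> ext_line \<phi> l \<subseteq> W \<longleftrightarrow> l \<subseteq> {x. ext_vec \<phi> x \<in> W}"
  unfolding ext_line_def
  using vec.span_superset[of "ext_vec \<phi> ` l"] vec.span_minimal[of "ext_vec \<phi> ` l" W] by blast

lemma subspace_ext_line: "vec.subspace (ext_line \<phi> l)"
  by (simp add: ext_line_def)

text \<open>\<open>ext_line\<close> is applied to points as well; in this way it embeds the points
  of PG(r,q) into those of the large space.\<close>

lemma ext_line_span_singleton: "ext_line \<phi> (vec.span {x}) = vec.span {ext_vec \<phi> x}"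
proof (intro subset_antisym)
  show "ext_line \<phi> (vec.span {x}) \<subseteq> vec.span {ext_vec \<phi> x}"
    unfolding ext_line_def
    by (rule vec.span_minimal[OF _ vec.subspace_span]) (auto simp: vec.span_singleton ext_vec_scale)
  show "vec.span {ext_vec \<phi> x} \<subseteq> ext_line \<phi> (vec.span {x})"
    by (simp add: span_singleton_subset_iff subspace_ext_line ext_vec_mem_ext_line_iff
        vec.span_base)
qed

lemma ext_line_pg_points: "R \<in> pg_points \<Longrightarrow> ext_line \<phi> R \<in> pg_points"
  by (metis pg_points_iff ext_line_span_singleton combine_0_right combine_eq_0_iff)

text \<open>A subspace is recovered from its extension as the trace on the vectors over the
  subfield.\<close>

lemma inj_on_ext_line: "inj_on (ext_line \<phi>) (Collect vec.subspace)"
proof (rule inj_onI)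
  fix l k :: "('a ^ 'n) set"
  assume "l \<in> Collect vec.subspace" "k \<in> Collect vec.subspace" "ext_line \<phi> l = ext_line \<phi> k"
  then have "x \<in> l \<longleftrightarrow> x \<in> k" for x
    using ext_vec_mem_ext_line_iff[of l x] ext_vec_mem_ext_line_iff[of k x] by simp
  then show "l = k" by blast
qed

text \<open>Independence survives extension: if \<open>ext_vec \<phi> y\<close> lay in the extension
  of the point spanned by \<open>x\<close>, then \<open>y\<close> would lie in that point.\<close>

lemma ext_line_pg_lines:
  assumes "l \<in> pg_lines"
  shows "ext_line \<phi> l \<in> pg_lines"
proof -
  obtain x y where xy: "x \<noteq> 0" "y \<notin> vec.span {x}" and l: "l = vec.span {x, y}"
    using assms pg_lines_iff by blast
  have "ext_vec \<phi> x \<noteq> 0"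
    using xy combine_0_right combine_eq_0_iff by metis
  moreover have "ext_vec \<phi> y \<notin> vec.span {ext_vec \<phi> x}"
    using xy by (simp add: ext_vec_mem_ext_line_iff flip: ext_line_span_singleton)
  moreover have "ext_line \<phi> l = vec.span {ext_vec \<phi> x, ext_vec \<phi> y}"
  proof (intro subset_antisym)
    have "l \<subseteq> {v. ext_vec \<phi> v \<in> vec.span {ext_vec \<phi> x, ext_vec \<phi> y}}"
      unfolding l
      by (rule vec.span_minimal)
        (auto simp: vec.subspace_def ext_vec_add ext_vec_scale ext_vec_0 vec.span_zero
          intro: vec.span_base vec.span_add vec.span_scale)
    then show "ext_line \<phi> l \<subseteq> vec.span {ext_vec \<phi> x, ext_vec \<phi> y}"
      by (simp add: ext_line_subset_iff)
    show "vec.span {ext_vec \<phi> x, ext_vec \<phi> y} \<subseteq> ext_line \<phi> l"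
      by (simp add: span_pair_subset_iff subspace_ext_line ext_vec_mem_ext_line_iff l vec.span_base)
  qed
  ultimately show ?thesis using pg_lines_iff by blast
qed

section \<open>Points of PG(r,q^2) inside and outside the subgeometry, and the extended lines
  through them\<close>

lemma nonreal_point:
  assumes "Q \<in> pg_points" "Q \<notin> ext_line \<phi> ` pg_points"
  obtains x y where "x \<noteq> 0" "y \<notin> vec.span {x}" "Q = vec.span {combine x y}"
proof -
  obtain v where "v \<noteq> 0" "Q = vec.span {v}"
    using assms(1) pg_points_iff by blast
  then obtain x y where Q: "Q = vec.span {combine x y}" and nz: "combine x y \<noteq> 0"
    using combine_exist by metis
  \<comment> \<open>If both components were multiples of one vector \<open>z\<close>, then
    \<open>Q\<close> would be the extension of the point spanned by \<open>z\<close>. Taking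
    \<open>y\<close> and then \<open>x\<close> for \<open>z\<close> yields the two
    conditions.\<close>
  have real: False if "z \<noteq> 0" "x \<in> vec.span {z}" "y \<in> vec.span {z}" for z
  proof -
    have "Q = ext_line \<phi> (vec.span {z})"
      using that nz Q combine_mem_ext_line_iff[of "vec.span {z}" x y]
        pg_point_eq_span[of "ext_line \<phi> (vec.span {z})" "combine x y"]
        ext_line_pg_points[of "vec.span {z}"] pg_points_iff by blast
    then show False using assms(2) that(1) pg_points_iff by blast
  qed
  have "x \<noteq> 0"
    using real[of y] nz by (auto simp: combine_eq_0_iff vec.span_zero vec.span_base)
  moreover have "y \<notin> vec.span {x}"
    using real[of x] \<open>x \<noteq> 0\<close> by (auto simp: vec.span_base)
  ultimately show thesis using that Q by blast
qed

text \<open>Were this point the extension of a point \<open>R\<close>, both components would lie in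
  \<open>R\<close>, making \<open>y\<close> a multiple of \<open>x\<close>.\<close>

lemma combine_nonreal:
  assumes "x \<noteq> 0" "y \<notin> vec.span {x}"
  shows "vec.span {combine x y} \<in> pg_points" "vec.span {combine x y} \<notin> ext_line \<phi> ` pg_points"
proof -
  show "vec.span {combine x y} \<in> pg_points"
    using assms(1) combine_eq_0_iff pg_points_iff by blast
  show "vec.span {combine x y} \<notin> ext_line \<phi> ` pg_points"
  proof
    assume "vec.span {combine x y} \<in> ext_line \<phi> ` pg_points"
    then obtain R where R: "R \<in> pg_points" "vec.span {combine x y} = ext_line \<phi> R" by blast
    then have "x \<in> R" "y \<in> R"
      using combine_mem_ext_line_iff[of R x y] pg_points_subspace
        vec.span_base[of "combine x y" "{combine x y}"] by auto
    then show False using pg_point_eq_span R(1) assms by blast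
  qed
qed

text \<open>A line whose extension contains the point contains both components, hence is the line
  they span.\<close>

lemma span_combine_subset_ext_line_iff:
  assumes "x \<noteq> 0" "y \<notin> vec.span {x}" "l \<in> pg_lines"
  shows "vec.span {combine x y} \<subseteq> ext_line \<phi> l \<longleftrightarrow> l = vec.span {x, y}"
proof -
  have "vec.span {combine x y} \<subseteq> ext_line \<phi> l \<longleftrightarrow> x \<in> l \<and> y \<in> l"
    using assms(3)
    by (simp add: span_singleton_subset_iff subspace_ext_line combine_mem_ext_line_iff
        pg_lines_subspace)
  then show ?thesis
    using assms pg_line_eq_span[of l x y] by (auto intro: vec.span_base)
qed

text \<open>This aligns the case distinction of \<open>tight_set\<close> with that of
  \<open>dual_symplectic_type\<close>.\<close>

lemma span_combine_mem_ext_points_iff: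
  assumes "x \<noteq> 0" "y \<notin> vec.span {x}" "L \<subseteq> pg_lines"
  shows "vec.span {combine x y} \<in> ext_points \<phi> L \<longleftrightarrow> vec.span {x, y} \<in> L"
  using assms combine_nonreal(1) span_combine_subset_ext_line_iff
  by (fastforce simp: ext_points_def)

text \<open>Since \<open>m\<close> is positive, some line of \<open>L\<close> passes through
  \<open>R\<close>. For a cover, the whole subgeometry therefore lies in
  \<open>ext_points \<phi> L\<close>.\<close>

lemma ext_line_mem_ext_points:
  assumes "R \<in> pg_points" "card {l \<in> L. R \<subseteq> l} = m" "0 < m"
  shows "ext_line \<phi> R \<in> ext_points \<phi> L"
proof -
  obtain l where "l \<in> L" "R \<subseteq> l"
    using assms(2,3) card_gt_0_iff by (metis (mono_tags, lifting) Collect_empty_eq)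
  moreover have "ext_line \<phi> R \<subseteq> ext_line \<phi> l"
    using vec.span_mono[OF image_mono[OF \<open>R \<subseteq> l\<close>]] by (simp add: ext_line_def)
  ultimately show ?thesis
    using assms(1) ext_line_pg_points by (auto simp: ext_points_def)
qed

text \<open>Double counting of the pairs of an extended line and a point of \<open>W\<close> on it:
  points of the subgeometry count \<open>m\<close> times, all others once. Adding \<open>N\<close>
  on the left avoids subtraction.\<close>

lemma sum_points_in_ext_cover:
  fixes L :: "('a ^ 'n) set set" and W :: "('b ^ 'n) set"
  assumes L: "L \<subseteq> pg_lines" and "0 < m"
    and cover: "\<And>P. P \<in> pg_points \<Longrightarrow> card {l \<in> L. P \<subseteq> l} = m"
    and W: "vec.subspace W"
  defines "N \<equiv> card (points_in {x. ext_vec \<phi> x \<in> W})"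
  shows "(\<Sum>l\<in>L. card (points_in (ext_line \<phi> l \<inter> W))) + N
    = card {Q \<in> ext_points \<phi> L. Q \<subseteq> W} + m * N"
proof -
  let ?T = "{Q \<in> ext_points \<phi> L. Q \<subseteq> W}" and ?R = "ext_line \<phi> ` pg_points"
  \<comment> \<open>All subgeometry points are in the cover, so those in \<open>W\<close> correspond
    to the points of the trace of \<open>W\<close>.\<close>
  have "?T \<inter> ?R = ext_line \<phi> ` points_in {x. ext_vec \<phi> x \<in> W}"
    using ext_line_mem_ext_points[OF _ cover \<open>0 < m\<close>] ext_line_subset_iff[OF W]
    by (auto simp: points_in_def)
  moreover have "inj_on (ext_line \<phi>) (points_in {x. ext_vec \<phi> x \<in> W})"
    by (rule inj_on_subset[OF inj_on_ext_line]) (auto simp: points_in_def pg_points_subspace)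
  ultimately have N: "card (?T \<inter> ?R) = N"
    by (simp add: N_def card_image)
  have deg: "card {l \<in> L. Q \<subseteq> ext_line \<phi> l} = (if Q \<in> ?R then m else 1)" if "Q \<in> ?T" for Q
  proof (cases "Q \<in> ?R")
    case True
    then obtain R where R: "R \<in> pg_points" "Q = ext_line \<phi> R" by blast
    have "Q \<subseteq> ext_line \<phi> l \<longleftrightarrow> R \<subseteq> l" if "l \<in> L" for l
      unfolding R(2) ext_line_subset_iff[OF subspace_ext_line]
      using that L by (simp add: ext_vec_mem_ext_line_iff pg_lines_subspace subset_iff)
    then have "{l \<in> L. Q \<subseteq> ext_line \<phi> l} = {l \<in> L. R \<subseteq> l}"
      by blast
    then show ?thesis using True R cover by simp
  next
    case False
    have "Q \<in> pg_points" using that by (simp add: ext_points_def)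
    then obtain x y where xy: "x \<noteq> 0" "y \<notin> vec.span {x}" "Q = vec.span {combine x y}"
      using False nonreal_point by blast
    then have "vec.span {x, y} \<in> L"
      using that L span_combine_mem_ext_points_iff by blast
    then have "{l \<in> L. Q \<subseteq> ext_line \<phi> l} = {vec.span {x, y}}"
      using L xy span_combine_subset_ext_line_iff by blast
    then show ?thesis using False by simp
  qed
  have "(\<Sum>l\<in>L. card (points_in (ext_line \<phi> l \<inter> W))) =
      (\<Sum>l\<in>L. card {Q \<in> ?T. Q \<subseteq> ext_line \<phi> l})"
    by (intro sum.cong arg_cong[where f = card]) (auto simp: points_in_def ext_points_def)
  also have "\<dots> = (\<Sum>Q\<in>?T. if Q \<in> ?R then m else 1)"
    by (rule sum_multicount_gen) (use deg in auto)
  also have "\<dots> = m * card (?T \<inter> ?R) + card (?T - ?R)"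
    by (simp add: sum.If_cases Diff_eq)
  also have "card (?T - ?R) + card (?T \<inter> ?R) = card ?T"
    by (subst card_Un_disjoint[symmetric]) (auto intro: arg_cong[where f = card])
  ultimately show ?thesis using N by simp
qed

end

section \<open>Symplectic forms and the sizes of the perps of points and lines\<close>

lemma symplectic_form_bilinear: "symplectic_form b \<Longrightarrow> bilinear_form b"
  by (simp add: symplectic_form_def)

lemma symplectic_form_swap:
  assumes "symplectic_form b"
  shows "b x y = - b y x"
proof -
  have alt: "b z z = 0" for z
    using assms by (simp add: symplectic_form_def)
  have "b x y + b y x = 0"
    using alt[of "x + y"]
    by (simp only: bilinear_formD[OF symplectic_form_bilinear[OF assms]])
      (simp add: alt add.commute)
  then show ?thesis by (simp add: eq_neg_iff_add_eq_0)
qed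

text \<open>Skew-symmetry carries nondegeneracy over to the second argument, as the functionals
  \<open>\<lambda>v. b v x\<close> that cut out perps require.\<close>

lemma symplectic_form_eq_0_left:
  assumes "symplectic_form b" "\<And>v. b v x = 0"
  shows "x = 0"
proof -
  have "b x v = 0" for v
    using assms(2)[of v] symplectic_form_swap[OF assms(1), of x v] by simp
  then show ?thesis
    using assms(1) by (simp add: symplectic_form_def)
qed

lemma card_perp_point:
  fixes b :: "'a::{field,finite} ^ 'n \<Rightarrow> 'a ^ 'n \<Rightarrow> 'a"
  assumes b: "symplectic_form b" and "x \<noteq> 0"
  shows "CARD('a) * card {v. b v x = 0} = CARD('a) ^ CARD('n)"
proof -
  note B = bilinear_formD[OF symplectic_form_bilinear[OF b]]
  obtain u where "b u x \<noteq> 0"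
    using symplectic_form_eq_0_left[OF b] \<open>x \<noteq> 0\<close> by blast
  then show ?thesis
    using card_kernel[of UNIV "\<lambda>v. b v x" u] by (simp add: B)
qed

text \<open>The hyperplane of \<open>x\<close> is cut once more by the functional of
  \<open>y\<close>. If that functional vanished there, it would be a multiple of the first, and
  nondegeneracy would make \<open>y\<close> a multiple of \<open>x\<close>.\<close>

lemma card_perp_line:
  fixes b :: "'a::{field,finite} ^ 'n \<Rightarrow> 'a ^ 'n \<Rightarrow> 'a"
  assumes b: "symplectic_form b" and xy: "x \<noteq> 0" "y \<notin> vec.span {x}"
  shows "CARD('a)\<^sup>2 * card (perp b (vec.span {x, y})) = CARD('a) ^ CARD('n)"
proof -
  note B = bilinear_formD[OF symplectic_form_bilinear[OF b]]
  have "\<exists>u. b u x = 0 \<and> b u y \<noteq> 0"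
  proof (rule ccontr)
    assume c: "\<not> ?thesis"
    obtain u where u: "b u x \<noteq> 0"
      using symplectic_form_eq_0_left[OF b] \<open>x \<noteq> 0\<close> by blast
    define k where "k = - (b u y / b u x)"
    have "b v (y + k *s x) = 0" for v
    proof -
      \<comment> \<open>Correcting \<open>v\<close> by a multiple of \<open>u\<close> moves it into
        the hyperplane of \<open>x\<close>, where the functional of \<open>y\<close> is assumed to
        vanish.\<close>
      have "b (v + (- (b v x / b u x)) *s u) x = 0"
        using u by (simp only: B) simp
      then have "b (v + (- (b v x / b u x)) *s u) y = 0" using c by blast
      then show ?thesis
        unfolding B k_def by (simp add: mult.commute)
    qed
    then have "y + k *s x = 0"
      by (rule symplectic_form_eq_0_left[OF b])
    then have "y = (- k) *s x"
      by (simp add: eq_neg_iff_add_eq_0 vec.scale_minus_left)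
    then show False
      using xy(2) vec.span_scale[OF vec.span_base[of x "{x}"], of "- k"] by simp
  qed
  then obtain u where u: "b u x = 0" "b u y \<noteq> 0" by blast
  have "perp b (vec.span {x, y}) = {v \<in> {v. b v x = 0}. b v y = 0}"
    unfolding perp_span[OF symplectic_form_bilinear[OF b]] by (auto simp: perp_def)
  moreover have "card {v. b v x = 0} = CARD('a) * card {v \<in> {v. b v x = 0}. b v y = 0}"
    by (rule card_kernel[of _ _ u]) (use u in \<open>auto intro!: subspace_kernel simp: B\<close>)
  ultimately show ?thesis
    using card_perp_point[OF b xy(1)] by (simp add: power2_eq_square)
qed

section \<open>Geometric sums and the incidence counts for a cover\<close>

lemma theta_geometric: "(real q - 1) * real (theta n q) = real q ^ nat (n + 1) - 1"
  unfolding theta_def by (simp add: power_diff_1_eq)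

text \<open>One identity for both kinds of points: they differ only in the trace \<open>W'\<close>.
  The sum of \<open>sum_points_in_ext_cover\<close> is evaluated line by line, each extended line
  being inside \<open>W\<close> or meeting it in one point.\<close>

lemma (in quadratic_extension) card_ext_points_perp:
  fixes b :: "'a ^ 'n \<Rightarrow> 'a ^ 'n \<Rightarrow> 'a" and p :: "'b ^ 'n"
  assumes cover: "m_cover b m L"
  defines "W \<equiv> {v. ext_form \<phi> b v p = 0}"
  defines "W' \<equiv> {x. ext_vec \<phi> x \<in> W}"
  shows "card {Q \<in> ext_points \<phi> L. Q \<subseteq> perp (ext_form \<phi> b) (vec.span {p})}
      + m * card (points_in W')
    = card L + (CARD('a))\<^sup>2 * card {l \<in> L. l \<subseteq> W'} + card (points_in W')"
proof -
  note B = bilinear_formD[OF bilinear_form_ext_form[of \<phi> b]]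
  have L: "L \<subseteq> pg_lines" and m: "0 < m"
    and c: "\<And>P. P \<in> pg_points \<Longrightarrow> card {l \<in> L. P \<subseteq> l} = m"
    using cover by (auto simp: m_cover_def symplectic_lines_def)
  have W: "vec.subspace W"
    unfolding W_def by (rule subspace_kernel) (simp_all add: B)
  have perp: "perp (ext_form \<phi> b) (vec.span {p}) = W"
    unfolding perp_span[OF bilinear_form_ext_form] by (auto simp: perp_def W_def)
  have "(\<Sum>l\<in>L. card (points_in (ext_line \<phi> l \<inter> W))) =
      (\<Sum>l\<in>L. if l \<subseteq> W' then (CARD('a))\<^sup>2 + 1 else 1)"
  proof (rule sum.cong)
    fix l assume "l \<in> L"
    then have l: "ext_line \<phi> l \<in> pg_lines" using L ext_line_pg_lines by blast
    have "l \<subseteq> W' \<longleftrightarrow> ext_line \<phi> l \<subseteq> W"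
      by (simp add: W'_def ext_line_subset_iff[OF W])
    then show "card (points_in (ext_line \<phi> l \<inter> W)) = (if l \<subseteq> W' then (CARD('a))\<^sup>2 + 1 else 1)"
      using card_points_in_line_kernel[OF l, of "\<lambda>v. ext_form \<phi> b v p"]
      by (simp add: B W_def card_ext)
  qed simp
  also have "\<dots> = card L + (CARD('a))\<^sup>2 * card {l \<in> L. l \<subseteq> W'}"
    by (rule sum_two_valued) simp
  finally show ?thesis
    using sum_points_in_ext_cover[OF L m c W] by (simp add: perp W'_def)
qed

text \<open>The same count over the subfield expresses the number of lines of \<open>L\<close> in a
  hyperplane through point and line totals.\<close>

lemma sum_card_points_in_hyperplane:
  fixes b :: "'a::{field,finite} ^ 'n \<Rightarrow> 'a ^ 'n \<Rightarrow> 'a"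
  assumes b: "bilinear_form b" and cover: "m_cover b m L"
  shows "card L + CARD('a) * card {l \<in> L. l \<subseteq> {v. b v x = 0}} = m * card (points_in {v. b v x = 0})"
proof -
  have L: "L \<subseteq> pg_lines" and c: "\<And>P. P \<in> pg_points \<Longrightarrow> card {l \<in> L. P \<subseteq> l} = m"
    using cover by (auto simp: m_cover_def symplectic_lines_def)
  have "m * card (points_in {v. b v x = 0}) = (\<Sum>l\<in>L. card (points_in (l \<inter> {v. b v x = 0})))"
    by (simp add: sum_points_in_cover[OF c])
  also have "\<dots> = (\<Sum>l\<in>L. if l \<subseteq> {v. b v x = 0} then CARD('a) + 1 else 1)"
    using L bilinear_formD[OF b]
    by (intro sum.cong refl card_points_in_line_kernel[where f = "\<lambda>v. b v x"]) auto
  also have "\<dots> = card L + CARD('a) * card {l \<in> L. l \<subseteq> {v. b v x = 0}}"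
    by (rule sum_two_valued) simp
  finally show ?thesis by simp
qed

lemma card_m_cover:
  fixes b :: "'a::{field,finite} ^ 'n \<Rightarrow> 'a ^ 'n \<Rightarrow> 'a"
  assumes cover: "m_cover b m L"
  shows "(CARD('a) + 1) * card L = m * card (points_in (UNIV :: ('a ^ 'n) set))"
proof -
  have L: "L \<subseteq> pg_lines" and c: "\<And>P. P \<in> pg_points \<Longrightarrow> card {l \<in> L. P \<subseteq> l} = m"
    using cover by (auto simp: m_cover_def symplectic_lines_def)
  have "m * card (points_in (UNIV :: ('a ^ 'n) set)) = (\<Sum>l\<in>L. card (points_in (l \<inter> UNIV)))"
    by (rule sum_points_in_cover[OF c, symmetric])
  also have "\<dots> = (\<Sum>l\<in>L. CARD('a) + 1)"
    \<comment> \<open>The zero functional has everything as its kernel, so each line contributes all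
      its points.\<close>
    using L card_points_in_line_kernel[of _ "\<lambda>v. 0"]
    by (intro sum.cong) auto
  finally show ?thesis by simp
qed

text \<open>\<open>Q\<close> stands for q and \<open>y\<close> for q^(r-3); \<open>l\<close> counts
  the lines of \<open>L\<close>, \<open>w\<^sub>0\<close> all points, \<open>w\<close> and
  \<open>c\<close> the points and the lines of \<open>L\<close> in a hyperplane, and
  \<open>t\<close> is the theta number of tightness. Multiplying by \<open>Q\<^sup>2 - 1\<close>
  clears the geometric sums and leaves a polynomial identity.\<close>

lemma real_point_count:
  fixes Q :: real
  assumes Q: "Q > 1"
    and eqs: "(Q + 1) * l = m * w\<^sub>0" "(Q - 1) * w\<^sub>0 = Q ^ 4 * y - 1"
      "(Q - 1) * w = Q ^ 3 * y - 1" "l + Q * c = m * w"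
      "N + m * w = l + Q\<^sup>2 * c + w" "(Q\<^sup>2 - 1) * t = Q\<^sup>2 * y - 1"
  shows "N = (m * (Q\<^sup>2 - Q) + Q + 1) * t + Q\<^sup>2 * y"
proof -
  have f: "Q\<^sup>2 - 1 = (Q - 1) * (Q + 1)"
    by (simp add: algebra_simps power2_eq_square)
  have "(Q\<^sup>2 - 1) * l = (Q - 1) * (m * w\<^sub>0)"
    by (simp only: f mult.assoc eqs(1))
  also have "\<dots> = m * ((Q - 1) * w\<^sub>0)" by (rule mult.left_commute)
  finally have l: "(Q\<^sup>2 - 1) * l = m * (Q ^ 4 * y - 1)" by (simp only: eqs(2))
  have "(Q\<^sup>2 - 1) * w = (Q + 1) * ((Q - 1) * w)"
    by (simp only: f mult.assoc mult.left_commute)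
  then have w: "(Q\<^sup>2 - 1) * w = (Q + 1) * (Q ^ 3 * y - 1)" by (simp only: eqs(3))
  \<comment> \<open>The count over the subfield eliminates \<open>c\<close>, leaving
    \<open>N\<close> in terms of \<open>l\<close> and \<open>w\<close>.\<close>
  have "Q\<^sup>2 * c = Q * (m * w - l)"
    by (simp add: eqs(4)[symmetric] power2_eq_square)
  then have N: "N = (1 - Q) * l + (Q * m + 1 - m) * w"
    using eqs(5) by (simp add: algebra_simps)
  have "(Q\<^sup>2 - 1) * N = (1 - Q) * ((Q\<^sup>2 - 1) * l) + (Q * m + 1 - m) * ((Q\<^sup>2 - 1) * w)"
    unfolding N by (simp add: algebra_simps)
  also have "\<dots> = (m * (Q\<^sup>2 - Q) + Q + 1) * ((Q\<^sup>2 - 1) * t) + (Q\<^sup>2 - 1) * (Q\<^sup>2 * y)"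
    unfolding l w eqs(6) by (simp add: algebra_simps eval_nat_numeral)
  also have "\<dots> = (Q\<^sup>2 - 1) * ((m * (Q\<^sup>2 - Q) + Q + 1) * t + Q\<^sup>2 * y)"
    by (simp only: distrib_left mult.left_commute)
  finally have "(Q\<^sup>2 - 1) * N = (Q\<^sup>2 - 1) * ((m * (Q\<^sup>2 - Q) + Q + 1) * t + Q\<^sup>2 * y)" .
  moreover have "Q\<^sup>2 - 1 \<noteq> 0"
    using one_less_power[OF Q, of 2] by simp
  ultimately show ?thesis by (rule mult_left_cancel[THEN iffD1, rotated])
qed

text \<open>Now \<open>w\<close> and \<open>a\<close> count the points and the lines of
  \<open>L\<close> in the perp of a line, \<open>u\<close> is the theta number of the dual
  condition, and \<open>e\<close> will indicate whether the line is in \<open>L\<close>. The excess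
  of \<open>N\<close> over its base value is \<open>Q\<^sup>2\<close> times the excess of
  \<open>a\<close> over \<open>m * u / (Q + 1)\<close>, and the extra terms q^(r-1) and q^(r-3) are
  in the same ratio.\<close>

lemma nonreal_point_count:
  fixes Q :: real
  assumes Q: "Q > 1"
    and eqs: "(Q + 1) * l = m * w\<^sub>0" "(Q - 1) * w\<^sub>0 = Q ^ 4 * y - 1"
      "(Q - 1) * w = Q\<^sup>2 * y - 1" "(Q - 1) * u = y - 1"
      "N + m * w = l + Q\<^sup>2 * a + w" "(Q\<^sup>2 - 1) * t = Q\<^sup>2 * y - 1"
  shows "N = (m * (Q\<^sup>2 - Q) + Q + 1) * t + e * (Q\<^sup>2 * y) \<longleftrightarrow> a = m * u / (Q + 1) + e * y"
proof -
  define v where "v = m * u / (Q + 1)"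
  have "(Q + 1) * v = m * u"
    using Q by (simp add: v_def)
  have f: "Q\<^sup>2 - 1 = (Q - 1) * (Q + 1)"
    by (simp add: algebra_simps power2_eq_square)
  have "(Q\<^sup>2 - 1) * l = (Q - 1) * (m * w\<^sub>0)"
    by (simp only: f mult.assoc eqs(1))
  also have "\<dots> = m * ((Q - 1) * w\<^sub>0)" by (rule mult.left_commute)
  finally have l: "(Q\<^sup>2 - 1) * l = m * (Q ^ 4 * y - 1)" by (simp only: eqs(2))
  have "(Q\<^sup>2 - 1) * v = (Q - 1) * (m * u)"
    by (simp only: f mult.assoc \<open>(Q + 1) * v = m * u\<close>)
  also have "\<dots> = m * ((Q - 1) * u)" by (rule mult.left_commute)
  finally have v: "(Q\<^sup>2 - 1) * v = m * (y - 1)" by (simp only: eqs(4))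
  have "(Q\<^sup>2 - 1) * w = (Q + 1) * ((Q - 1) * w)"
    by (simp only: f mult.assoc mult.left_commute)
  then have w: "(Q\<^sup>2 - 1) * w = (Q + 1) * (Q\<^sup>2 * y - 1)" by (simp only: eqs(3))
  have N: "N = l + Q\<^sup>2 * a + (1 - m) * w"
    using eqs(5) by (simp add: algebra_simps)
  let ?I = "m * (Q\<^sup>2 - Q) + Q + 1"
  have "(Q\<^sup>2 - 1) * (N - ?I * t) =
      (Q\<^sup>2 - 1) * l + (Q\<^sup>2 - 1) * (Q\<^sup>2 * a) + (1 - m) * ((Q\<^sup>2 - 1) * w) - ?I * ((Q\<^sup>2 - 1) * t)"
    unfolding N by (simp add: algebra_simps)
  also have "\<dots> = (Q\<^sup>2 - 1) * (Q\<^sup>2 * a) - Q\<^sup>2 * ((Q\<^sup>2 - 1) * v)"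
    unfolding l w v eqs(6) by (simp add: algebra_simps eval_nat_numeral)
  also have "\<dots> = (Q\<^sup>2 - 1) * (Q\<^sup>2 * (a - v))"
    by (simp only: right_diff_distrib mult.left_commute)
  finally have "(Q\<^sup>2 - 1) * (N - ?I * t) = (Q\<^sup>2 - 1) * (Q\<^sup>2 * (a - v))" .
  moreover have "Q\<^sup>2 - 1 \<noteq> 0"
    using one_less_power[OF Q, of 2] by simp
  ultimately have "N - ?I * t = Q\<^sup>2 * (a - v)"
    by (rule mult_left_cancel[THEN iffD1, rotated])
  then have "N = ?I * t + e * (Q\<^sup>2 * y) \<longleftrightarrow> Q\<^sup>2 * (a - v) = Q\<^sup>2 * (e * y)"
    by (simp only: diff_eq_eq mult.left_commute) (simp add: add.commute)
  also have "\<dots> \<longleftrightarrow> a - v = e * y"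
    using Q by (intro mult_left_cancel) simp
  finally show ?thesis
    unfolding v_def by (simp only: diff_eq_eq add.commute)
qed

section \<open>Comparing tightness at points with the dual condition on lines\<close>

theorem theorem3p5:
  fixes b :: "('a::{field,finite}) ^ 'n \<Rightarrow> 'a ^ 'n \<Rightarrow> 'a"
    and \<phi> :: "'a \<Rightarrow> 'b::{field,finite}"
    and L :: "('a ^ 'n) set set"
    and r q m :: nat
  assumes "3 \<le> r" and "odd r"
    and "CARD('n) = r + 1"
    and "CARD('a) = q"
    and "CARD('b) = q\<^sup>2"
    and "field_embedding \<phi>"
    and "symplectic_form b"
    and "m_cover b m L"
  shows "tight_set r q (ext_form \<phi> b) (m * (q\<^sup>2 - q) + q + 1) (ext_points \<phi> L)
         \<longleftrightarrow> dual_symplectic_type r q b m L"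
proof -
  note b = \<open>symplectic_form b\<close> and cover = \<open>m_cover b m L\<close>
  note bil = symplectic_form_bilinear[OF b]
  have "card {0, 1 :: 'a} \<le> CARD('a)"
    by (rule card_mono) auto
  then have q: "2 \<le> q"
    using \<open>CARD('a) = q\<close> by simp
  \<comment> \<open>The image has at most q elements, fewer than q^2, which leaves room for
    \<omega>.\<close>
  have "range \<phi> \<noteq> UNIV"
  proof
    assume "range \<phi> = UNIV"
    then have "q\<^sup>2 \<le> q"
      using card_image_le[of UNIV \<phi>] assms(4,5) by simp
    then show False using q by (simp add: power2_eq_square)
  qed
  then obtain \<omega> where "\<omega> \<notin> range \<phi>" by blast
  then interpret quadratic_extension \<phi> \<omega>
    using assms by unfold_locales auto
  \<comment> \<open>Oddness makes \<open>k\<close> the exact half of \<open>r - 3\<close>, so that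
    all powers needed are small powers of \<open>Q\<close> times \<open>y\<close>.\<close>
  have "\<exists>k. r = 2 * k + 3"
    using \<open>3 \<le> r\<close> \<open>odd r\<close> by presburger
  then obtain k where r: "r = 2 * k + 3" by blast
  have L: "L \<subseteq> pg_lines" and m: "0 < m"
    and deg: "\<And>P. P \<in> pg_points \<Longrightarrow> card {l \<in> L. P \<subseteq> l} = m"
    using cover by (auto simp: m_cover_def symplectic_lines_def)
  define Q y where "Q = real q" and "y = Q ^ (2 * k)"
  define t u where "t = theta ((int r - 3) div 2) (q\<^sup>2)" and "u = theta (int r - 4) q"
  define i where "i = m * (q\<^sup>2 - q) + q + 1"
  define N where "N P = card {R \<in> ext_points \<phi> L. R \<subseteq> perp (ext_form \<phi> b) P}" for P
  have Q: "Q > 1" using q by (simp add: Q_def)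
  have i: "real i = real m * (Q\<^sup>2 - Q) + Q + 1"
    using q by (simp add: i_def Q_def of_nat_diff power2_eq_square)
  have y: "real q ^ (r - 1) = Q\<^sup>2 * y" "real q ^ (r - 3) = y" "real q ^ (r + 1) = Q ^ 4 * y"
    by (simp_all add: r y_def Q_def power_add[symmetric] eval_nat_numeral)
  have t: "(Q\<^sup>2 - 1) * real t = Q\<^sup>2 * y - 1"
  proof -
    have e: "(int r - 3) div 2 = int k" by (simp add: r)
    show ?thesis
      using theta_geometric[of "q\<^sup>2" "int k"]
      unfolding t_def e by (simp add: y_def Q_def nat_add_distrib power_mult power2_eq_square)
  qed
  have u: "(Q - 1) * real u = y - 1"
  proof -
    \<comment> \<open>For \<open>r = 3\<close> the exponent is 0, in agreement with the value 0 of
      theta at -1.\<close>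
    have "nat (int r - 4 + 1) = 2 * k" by (simp add: r)
    then show ?thesis
      using theta_geometric[of q "int r - 4"] unfolding u_def by (simp add: y_def Q_def)
  qed
  have points: "(Q - 1) * real (card (points_in W)) = real (card W) - 1"
    if "vec.subspace W" for W :: "('a ^ 'n) set"
    using card_points_in[OF that] \<open>CARD('a) = q\<close> q by (simp add: Q_def of_nat_diff)
  define w\<^sub>0 where "w\<^sub>0 = card (points_in (UNIV :: ('a ^ 'n) set))"
  have w0: "(Q - 1) * real w\<^sub>0 = Q ^ 4 * y - 1"
    using points[of UNIV] y(3) by (simp add: w\<^sub>0_def assms(3,4))
  have "real ((q + 1) * card L) = real (m * w\<^sub>0)"
    using card_m_cover[OF cover] by (simp only: w\<^sub>0_def assms(4))
  then have l: "(Q + 1) * real (card L) = real m * real w\<^sub>0"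
    by (simp add: Q_def algebra_simps)
  note hom_form = ext_form_ext_vec[OF embedding bil]
  note ext_bil = bilinear_formD[OF bilinear_form_ext_form[of \<phi> b]]

  \<comment> \<open>At a point of the subgeometry the trace of the perp is a hyperplane, and the
    covering property alone forces the tight value.\<close>
  have real: "N (ext_line \<phi> R) = i * t + q ^ (r - 1)" if R: "R \<in> pg_points" for R
  proof -
    obtain x where x: "x \<noteq> 0" "R = vec.span {x}"
      using R pg_points_iff by blast
    let ?W = "{v. b v x = 0}"
    have W: "{v. ext_vec \<phi> v \<in> {v. ext_form \<phi> b v (ext_vec \<phi> x) = 0}} = ?W"
      by (simp add: hom_form hom_eq_0_iff)
    have "real (CARD('a) * card ?W) = real (CARD('a) ^ CARD('n))"
      by (simp only: card_perp_point[OF b x(1)])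
    then have "Q * real (card ?W) = Q ^ 4 * y"
      by (simp only: of_nat_mult of_nat_power assms(3,4) y(3) Q_def)
    also have "\<dots> = Q * (Q ^ 3 * y)"
      by (simp add: eval_nat_numeral)
    finally have "real (card ?W) = Q ^ 3 * y" using Q by simp
    moreover have "vec.subspace ?W"
      by (rule subspace_kernel) (simp_all add: bilinear_formD[OF bil])
    ultimately have w: "(Q - 1) * real (card (points_in ?W)) = Q ^ 3 * y - 1"
      using points by simp
    have "real (card L + q * card {l \<in> L. l \<subseteq> ?W}) = real (m * card (points_in ?W))"
      using sum_card_points_in_hyperplane[OF bil cover, of x] by (simp only: assms(4))
    then have c: "real (card L) + Q * real (card {l \<in> L. l \<subseteq> ?W}) = real m * real (card (points_in ?W))"
      by (simp add: Q_def)
    have "real (N R' + m * card (points_in ?W)) =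
        real (card L + q\<^sup>2 * card {l \<in> L. l \<subseteq> ?W} + card (points_in ?W))"
      if "R' = ext_line \<phi> R" for R'
      using card_ext_points_perp[OF cover, of "ext_vec \<phi> x"]
      unfolding W that N_def x(2) ext_line_span_singleton by (simp only: assms(4))
    then have n: "real (N (ext_line \<phi> R)) + real m * real (card (points_in ?W)) =
        real (card L) + Q\<^sup>2 * real (card {l \<in> L. l \<subseteq> ?W}) + real (card (points_in ?W))"
      by (simp add: Q_def)
    have "real (N (ext_line \<phi> R)) = real (i * t + q ^ (r - 1))"
      using real_point_count[OF Q l w0 w c n t]
      by (simp only: of_nat_add of_nat_mult of_nat_power i y(1))
    then show ?thesis by (simp only: of_nat_eq_iff)
  qed

  have nonreal: "N P = (if P \<in> ext_points \<phi> L then i * t + q ^ (r - 1) else i * t) \<longleftrightarrow>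
      real (card {k \<in> L. k \<subseteq> perp b l}) =
        (if l \<in> L then real m * real u / (Q + 1) + Q ^ (r - 3) else real m * real u / (Q + 1))"
    if xy: "x \<noteq> 0" "y' \<notin> vec.span {x}"
      and P: "P = vec.span {combine x y'}" and l': "l = vec.span {x, y'}"
    for x y' P l
  proof -
    let ?W = "perp b l"
    \<comment> \<open>The coordinates with respect to 1 and \<omega> must vanish separately, so the
      trace of the perp of \<open>P\<close> is the perp of \<open>l\<close>.\<close>
    have "ext_form \<phi> b (ext_vec \<phi> v) (combine x y') = \<phi> (b v x) + \<omega> * \<phi> (b v y')" for v
      by (simp add: combine_def ext_bil hom_form)
    then have W: "{v. ext_vec \<phi> v \<in> {v. ext_form \<phi> b v (combine x y') = 0}} = ?W"
      unfolding l' perp_span[OF bil] by (auto simp: perp_def coords_eq_0)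
    have "real (CARD('a)\<^sup>2 * card ?W) = real (CARD('a) ^ CARD('n))"
      by (simp only: l' card_perp_line[OF b xy])
    then have "Q\<^sup>2 * real (card ?W) = Q ^ 4 * y"
      by (simp only: of_nat_mult of_nat_power assms(3,4) y(3) Q_def)
    also have "\<dots> = Q\<^sup>2 * (Q\<^sup>2 * y)"
      by (simp add: eval_nat_numeral)
    finally have "real (card ?W) = Q\<^sup>2 * y" using Q by (simp only: mult_cancel_left) auto
    then have w: "(Q - 1) * real (card (points_in ?W)) = Q\<^sup>2 * y - 1"
      using points subspace_perp[OF bil] by simp
    have "real (N P + m * card (points_in ?W)) =
        real (card L + q\<^sup>2 * card {k \<in> L. k \<subseteq> ?W} + card (points_in ?W))"
      using card_ext_points_perp[OF cover, of "combine x y'"]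
      unfolding W P N_def by (simp only: assms(4))
    then have n: "real (N P) + real m * real (card (points_in ?W)) =
        real (card L) + Q\<^sup>2 * real (card {k \<in> L. k \<subseteq> ?W}) + real (card (points_in ?W))"
      by (simp add: Q_def)
    \<comment> \<open>A 0-1 factor merges the two cases into the single equation handled by
      \<open>nonreal_point_count\<close>.\<close>
    define e where "e = (if l \<in> L then 1 else 0 :: nat)"
    have mem: "P \<in> ext_points \<phi> L \<longleftrightarrow> l \<in> L"
      unfolding P l' by (rule span_combine_mem_ext_points_iff[OF xy L])
    have "N P = (if P \<in> ext_points \<phi> L then i * t + q ^ (r - 1) else i * t) \<longleftrightarrow>
        N P = i * t + e * q ^ (r - 1)"
      by (simp add: mem e_def)
    also have "\<dots> \<longleftrightarrow> real (N P) = real (i * t + e * q ^ (r - 1))"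
      by (simp only: of_nat_eq_iff)
    also have "\<dots> \<longleftrightarrow> real (N P) = (real m * (Q\<^sup>2 - Q) + Q + 1) * real t + real e * (Q\<^sup>2 * y)"
      by (simp only: of_nat_add of_nat_mult of_nat_power i y(1))
    also have "\<dots> \<longleftrightarrow> real (card {k \<in> L. k \<subseteq> ?W}) = real m * real u / (Q + 1) + real e * y"
      by (rule nonreal_point_count[OF Q l w0 w u n t])
    also have "\<dots> \<longleftrightarrow> real (card {k \<in> L. k \<subseteq> ?W}) =
        (if l \<in> L then real m * real u / (Q + 1) + Q ^ (r - 3) else real m * real u / (Q + 1))"
      using y(2) by (simp add: e_def Q_def)
    finally show ?thesis .
  qed

  let ?tight = "\<lambda>P. N P = (if P \<in> ext_points \<phi> L then i * t + q ^ (r - 1) else i * t)"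
  let ?dual = "\<lambda>l. real (card {k \<in> L. k \<subseteq> perp b l}) =
      (if l \<in> L then real m * real u / (Q + 1) + Q ^ (r - 3) else real m * real u / (Q + 1))"
  have "(\<forall>P\<in>pg_points. ?tight P) \<longleftrightarrow> (\<forall>l\<in>pg_lines. ?dual l)"
  proof
    assume tight: "\<forall>P\<in>pg_points. ?tight P"
    show "\<forall>l\<in>pg_lines. ?dual l"
    proof
      fix l :: "('a ^ 'n) set" assume "l \<in> pg_lines"
      then obtain x y' where xy: "x \<noteq> 0" "y' \<notin> vec.span {x}" "l = vec.span {x, y'}"
        using pg_lines_iff by blast
      \<comment> \<open>The extension of every line carries the point spanned by
        \<open>combine x y'\<close>, so tightness tests the dual condition at each line.\<close>
      then show "?dual l"
        using nonreal[OF xy(1,2) refl xy(3)] tight combine_nonreal(1)[OF xy(1,2)] by blast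
    qed
  next
    assume dual: "\<forall>l\<in>pg_lines. ?dual l"
    show "\<forall>P\<in>pg_points. ?tight P"
    proof
      fix P :: "('b ^ 'n) set" assume P: "P \<in> pg_points"
      show "?tight P"
      \<comment> \<open>Points of the subgeometry are in the cover and settled by
        \<open>real\<close>; every other point is governed by the line its components span.\<close>
      proof (cases "P \<in> ext_line \<phi> ` pg_points")
        case True
        then obtain R where R: "R \<in> pg_points" "P = ext_line \<phi> R" by blast
        then show ?thesis
          using real[OF R(1)] ext_line_mem_ext_points[OF R(1) deg[OF R(1)] m] by simp
      next
        case False
        then obtain x y' where xy: "x \<noteq> 0" "y' \<notin> vec.span {x}" "P = vec.span {combine x y'}"
          using P nonreal_point by blast
        then have "vec.span {x, y'} \<in> pg_lines" using pg_lines_iff by blast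
        then show ?thesis
          using nonreal[OF xy(1,2,3) refl] dual by blast
      qed
    qed
  qed
  moreover have "ext_points \<phi> L \<subseteq> pg_points"
    by (auto simp: ext_points_def)
  ultimately show ?thesis
    by (simp only: tight_set_def dual_symplectic_type_def N_def i_def t_def u_def Q_def simp_thms)
qed

end
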